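(* Let $(Q,*,/)$ be a $2$-reductive quandle. Then $(Q,*^n,*^m,*,/)$ is an oriented bondle for every $n,m\in\mathbb{Z}$.
   Context: A quandle is a set $Q$ with two binary operations $*,/$ such that for all $x,y,z\in Q$: $(x*y)/y=x=(x/y)*y$, $x*x=x$, and $(x*y)*z=(x*z)*(y*z)$. In particular each right multiplication $\rho_y:x\mapsto x*y$ is a bijection of $Q$ with $\rho_y^{-1}(x)=x/y$. A quandle $(Q,*,/)$ is $2$-reductive if $x*(y*z)=x*(y*u)$ for all $x,y,z,u\in Q$. For $n\in\mathbb{Z}$, the operation $*^n$ on $Q$ is defined by $x*^n y=\rho_y^n(x)$. An oriented singquandle is a binary algebraic structure $(Q,\cdot,*,/)$ (a set $Q$ with three binary operations) such that $(Q,*,/)$ is a quandle and the following identities hold for all $x,y,z\in Q$: (OS1') $(y\cdot x)*z=(y*z)\cdot(x*z)$; (OS2') $(x\cdot(y\cdot x))*z=(x*z)\cdot((y*z)\cdot(x*z))$; (OS3') $(y*x)*z=(y*(z\cdot x))*((x*z)\cdot z)$; (OS4') $(y\cdot x)*((x*y)\cdot y)=(y*(x*y))\cdot(x*y)$. An oriented bondle is a binary algebraic structure $(Q,\cdot,\bullet,*,/)$ (a set $Q$ with four binary operations) such that $(Q,\cdot,*,/)$ is an oriented singquandle and the following identities hold for all $x,y,z\in Q$: (OB1') $(x\bullet y)*z=(x*z)\bullet(y*z)$; (OB3') $(z/(y\bullet x))*x=(z/y)*(x\bullet y)$; (OB4') $(y\bullet x)/y=y\bullet(x/(x\bullet y))$.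 In the claim, the operations $*^n,*^m,*,/$ play the roles of $\cdot,\bullet,*,/$ respectively in this definition. *)

theory Defs
  imports "HOL-Algebra.Bij"
begin

text \<open>Structures are given by a (possibly empty) carrier set \<open>Q\<close> together with binary operations
  under which \<open>Q\<close> is closed; all identities are required on \<open>Q\<close> only.\<close>

locale quandle =
  fixes Q :: "'a set"
    and star :: "'a \<Rightarrow> 'a \<Rightarrow> 'a" (infixl "\<star>" 70)
    and slash :: "'a \<Rightarrow> 'a \<Rightarrow> 'a" (infixl "\<oslash>" 70)
  assumes star_closed: "\<lbrakk>x \<in> Q; y \<in> Q\<rbrakk> \<Longrightarrow> x \<star> y \<in> Q"
    and slash_closed: "\<lbrakk>x \<in> Q; y \<in> Q\<rbrakk> \<Longrightarrow> x \<oslash> y \<in> Q"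
    and star_slash: "\<lbrakk>x \<in> Q; y \<in> Q\<rbrakk> \<Longrightarrow> (x \<star> y) \<oslash> y = x"
    and slash_star: "\<lbrakk>x \<in> Q; y \<in> Q\<rbrakk> \<Longrightarrow> (x \<oslash> y) \<star> y = x"
    and idem: "x \<in> Q \<Longrightarrow> x \<star> x = x"
    and distrib: "\<lbrakk>x \<in> Q; y \<in> Q; z \<in> Q\<rbrakk> \<Longrightarrow> (x \<star> y) \<star> z = (x \<star> z) \<star> (y \<star> z)"

locale two_reductive_quandle = quandle +
  assumes two_reductive:
    "\<lbrakk>x \<in> Q; y \<in> Q; z \<in> Q; u \<in> Q\<rbrakk> \<Longrightarrow> x \<star> (y \<star> z) = x \<star> (y \<star> u)"

definition right_mult :: "'a set \<Rightarrow> ('a \<Rightarrow> 'a \<Rightarrow> 'a) \<Rightarrow> 'a \<Rightarrow> 'a \<Rightarrow> 'a"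
  where "right_mult Q star y = (\<lambda>x\<in>Q. star x y)"

text \<open>The operation \<open>x *\<^sup>n y = \<rho>\<^sub>y\<^sup>n(x)\<close>: the integer power of the right multiplication
  \<open>\<rho>\<^sub>y\<close> is taken in the group of all bijections of \<open>Q\<close>, of which \<open>\<rho>\<^sub>y\<close> is an element
  whenever \<open>Q\<close> is a quandle and \<open>y \<in> Q\<close>. Elements of \<open>BijGroup Q\<close> are extensional functions,
  hence the restriction to \<open>Q\<close> in \<open>right_mult\<close>.\<close>

definition star_pow :: "'a set \<Rightarrow> ('a \<Rightarrow> 'a \<Rightarrow> 'a) \<Rightarrow> int \<Rightarrow> 'a \<Rightarrow> 'a \<Rightarrow> 'a"
  where "star_pow Q star n x y = (right_mult Q star y [^]\<^bsub>BijGroup Q\<^esub> n) x"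

locale oriented_singquandle = quandle Q star slash
  for Q :: "'a set"
    and dot :: "'a \<Rightarrow> 'a \<Rightarrow> 'a" (infixl "\<cdot>" 70)
    and star :: "'a \<Rightarrow> 'a \<Rightarrow> 'a" (infixl "\<star>" 70)
    and slash :: "'a \<Rightarrow> 'a \<Rightarrow> 'a" (infixl "\<oslash>" 70) +
  assumes dot_closed: "\<lbrakk>x \<in> Q; y \<in> Q\<rbrakk> \<Longrightarrow> x \<cdot> y \<in> Q"
    and OS1: "\<lbrakk>x \<in> Q; y \<in> Q; z \<in> Q\<rbrakk> \<Longrightarrow>
      (y \<cdot> x) \<star> z = (y \<star> z) \<cdot> (x \<star> z)"
    and OS2: "\<lbrakk>x \<in> Q; y \<in> Q; z \<in> Q\<rbrakk> \<Longrightarrow>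
      (x \<cdot> (y \<cdot> x)) \<star> z = (x \<star> z) \<cdot> ((y \<star> z) \<cdot> (x \<star> z))"
    and OS3: "\<lbrakk>x \<in> Q; y \<in> Q; z \<in> Q\<rbrakk> \<Longrightarrow>
      (y \<star> x) \<star> z = (y \<star> (z \<cdot> x)) \<star> ((x \<star> z) \<cdot> z)"
    and OS4: "\<lbrakk>x \<in> Q; y \<in> Q\<rbrakk> \<Longrightarrow>
      (y \<cdot> x) \<star> ((x \<star> y) \<cdot> y) = (y \<star> (x \<star> y)) \<cdot> (x \<star> y)"

locale oriented_bondle = oriented_singquandle Q dot star slash
  for Q :: "'a set"
    and dot :: "'a \<Rightarrow> 'a \<Rightarrow> 'a" (infixl "\<cdot>" 70)
    and bullet :: "'a \<Rightarrow> 'a \<Rightarrow> 'a" (infixl "\<bullet>" 70)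
    and star :: "'a \<Rightarrow> 'a \<Rightarrow> 'a" (infixl "\<star>" 70)
    and slash :: "'a \<Rightarrow> 'a \<Rightarrow> 'a" (infixl "\<oslash>" 70) +
  assumes bullet_closed: "\<lbrakk>x \<in> Q; y \<in> Q\<rbrakk> \<Longrightarrow> x \<bullet> y \<in> Q"
    and OB1: "\<lbrakk>x \<in> Q; y \<in> Q; z \<in> Q\<rbrakk> \<Longrightarrow>
      (x \<bullet> y) \<star> z = (x \<star> z) \<bullet> (y \<star> z)"
    and OB3: "\<lbrakk>x \<in> Q; y \<in> Q; z \<in> Q\<rbrakk> \<Longrightarrow>
      (z \<oslash> (y \<bullet> x)) \<star> x = (z \<oslash> y) \<star> (x \<bullet> y)"
    and OB4: "\<lbrakk>x \<in> Q; y \<in> Q\<rbrakk> \<Longrightarrow>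
      (y \<bullet> x) \<oslash> y = y \<bullet> (x \<oslash> (x \<bullet> y))"

end

(* Since x * (y * z) = x * (y * y) = x * y, the right multiplications by y * z and y coincide,
   and then right distributivity says that any two right multiplications commute. Hence the right
   multiplications by y *^n z and y / z also coincide with that by y, and every bondle identity
   reduces to commuting powers of right multiplications; OB4 also uses y / y = y. *)
theory Submission imports Defs begin

lemma carrier_BijGroup: "carrier (BijGroup S) = Bij S"
  by (simp add: BijGroup_def)

context quandle
begin

lemma slash_eqI: "\<lbrakk>y \<in> Q; z \<in> Q; x = y \<star> z\<rbrakk> \<Longrightarrow> x \<oslash> z = y"
  by (simp add: star_slash)

lemma slash_idem: "x \<in> Q \<Longrightarrow> x \<oslash> x = x"
  by (simp add: slash_eqI idem)

text \<open>Division by \<open>y\<close> is the inverse map; membership in the group makes the laws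
  for integer powers available.\<close>

lemma right_mult_in_Bij:
  assumes "y \<in> Q"
  shows "right_mult Q star y \<in> Bij Q"
proof -
  have "bij_betw (right_mult Q star y) Q Q"
    by (rule bij_betw_byWitness[where f' = "\<lambda>x. x \<oslash> y"])
      (use assms in \<open>auto simp: right_mult_def star_closed slash_closed star_slash slash_star\<close>)
  then show ?thesis
    by (simp add: Bij_def right_mult_def)
qed

lemma right_mult_int_pow_in_Bij:
  assumes "y \<in> Q"
  shows "right_mult Q star y [^]\<^bsub>BijGroup Q\<^esub> (n :: int) \<in> Bij Q"
  using group.int_pow_closed[OF group_BijGroup, of "right_mult Q star y" Q n]
    right_mult_in_Bij[OF assms]
  by (simp only: carrier_BijGroup)

lemma star_pow_closed:
  assumes "x \<in> Q" "y \<in> Q"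
  shows "star_pow Q star n x y \<in> Q"
  unfolding star_pow_def
  using Bij_imp_funcset[OF right_mult_int_pow_in_Bij[OF assms(2)]] assms(1)
  by (rule funcset_mem)

lemma star_pow_0: "x \<in> Q \<Longrightarrow> star_pow Q star 0 x y = x"
  unfolding star_pow_def int_pow_0 by (simp add: BijGroup_def)

text \<open>With \<open>star_pow_0\<close> and \<open>star_pow_diff_1\<close> this gives a recursion
  in both directions from 0, so that later inductions never touch the group.\<close>

lemma star_pow_add_1:
  assumes "x \<in> Q" "y \<in> Q"
  shows "star_pow Q star (n + 1) x y = star_pow Q star n x y \<star> y"
proof -
  interpret group "BijGroup Q" by (rule group_BijGroup)
  let ?r = "right_mult Q star y"
  have r: "?r \<in> carrier (BijGroup Q)"
    using right_mult_in_Bij[OF assms(2)] by (simp only: carrier_BijGroup)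
  \<comment> \<open>The exponent is split as \<open>1 + n\<close>: the left factor of a composition
    acts last, which yields the outer \<open>\<star> y\<close>.\<close>
  have "?r [^]\<^bsub>BijGroup Q\<^esub> (n + 1) = ?r \<otimes>\<^bsub>BijGroup Q\<^esub> ?r [^]\<^bsub>BijGroup Q\<^esub> n"
    using int_pow_mult[OF r, of 1 n] by (simp only: add.commute int_pow_1[OF r])
  also have "\<dots> = compose Q ?r (?r [^]\<^bsub>BijGroup Q\<^esub> n)"
    using right_mult_in_Bij[OF assms(2)] right_mult_int_pow_in_Bij[OF assms(2), of n]
    by (simp add: BijGroup_def)
  finally show ?thesis
    using assms star_pow_closed[OF assms, of n]
    by (simp add: star_pow_def compose_def right_mult_def)
qed

lemma star_pow_diff_1:
  assumes "x \<in> Q" "y \<in> Q"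
  shows "star_pow Q star (n - 1) x y = star_pow Q star n x y \<oslash> y"
  using star_pow_add_1[OF assms, of "n - 1"] assms
  by (simp add: star_slash star_pow_closed)

end

context two_reductive_quandle
begin

lemma star_star_right: "\<lbrakk>x \<in> Q; y \<in> Q; z \<in> Q\<rbrakk> \<Longrightarrow> x \<star> (y \<star> z) = x \<star> y"
  using two_reductive[of x y z y] by (simp add: idem)

text \<open>Write \<open>y\<close> as \<open>(y \<oslash> z) \<star> z\<close>; the outer factor
  \<open>z\<close> is then ignored.\<close>

lemma star_slash_right:
  assumes "x \<in> Q" "y \<in> Q" "z \<in> Q"
  shows "x \<star> (y \<oslash> z) = x \<star> y"
  using star_star_right[of x "y \<oslash> z" z] assms by (simp add: slash_closed slash_star)

lemma star_commute: "\<lbrakk>x \<in> Q; y \<in> Q; z \<in> Q\<rbrakk> \<Longrightarrow> (x \<star> y) \<star> z = (x \<star> z) \<star> y"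
  using distrib[of x y z] by (simp add: star_star_right star_closed)

lemma slash_star_commute:
  assumes "x \<in> Q" "y \<in> Q" "z \<in> Q"
  shows "(x \<star> z) \<oslash> y = (x \<oslash> y) \<star> z"
  using assms star_commute[of "x \<oslash> y" z y]
  by (intro slash_eqI) (simp_all add: star_closed slash_closed slash_star)

lemma star_star_pow_right:
  assumes "x \<in> Q" "y \<in> Q" "z \<in> Q"
  shows "x \<star> star_pow Q star n y z = x \<star> y"
  by (induction n rule: int_induct[where k = 0])
    (use assms in \<open>simp_all add: star_pow_0 star_pow_add_1 star_pow_diff_1 star_pow_closed
      star_star_right star_slash_right\<close>)

text \<open>Equal bijections have equal inverses:
  \<open>(x \<oslash> z) \<star> y = (x \<oslash> z) \<star> z = x\<close>.\<close>

lemma slash_cong_right: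
  assumes "x \<in> Q" "y \<in> Q" "z \<in> Q" and "\<And>u. u \<in> Q \<Longrightarrow> u \<star> y = u \<star> z"
  shows "x \<oslash> y = x \<oslash> z"
  using assms by (intro slash_eqI) (simp_all add: slash_closed slash_star)

lemma slash_star_pow_right:
  "\<lbrakk>x \<in> Q; y \<in> Q; z \<in> Q\<rbrakk> \<Longrightarrow> x \<oslash> star_pow Q star n y z = x \<oslash> y"
  by (rule slash_cong_right) (simp_all add: star_pow_closed star_star_pow_right)

lemma star_pow_star_commute:
  assumes "x \<in> Q" "y \<in> Q" "z \<in> Q"
  shows "star_pow Q star n (x \<star> z) y = star_pow Q star n x y \<star> z"
  by (induction n rule: int_induct[where k = 0])
    \<comment> \<open>Both commutation rules are directed so that the factor \<open>z\<close> moves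
      outward past \<open>y\<close>.\<close>
    (use assms in \<open>simp_all add: star_pow_0 star_pow_add_1 star_pow_diff_1 star_pow_closed
      star_closed star_commute[of _ z y] slash_star_commute\<close>)

lemma star_pow_slash_commute:
  assumes "x \<in> Q" "y \<in> Q" "z \<in> Q"
  shows "star_pow Q star n (x \<oslash> z) y = star_pow Q star n x y \<oslash> z"
  using assms star_pow_star_commute[of "x \<oslash> z" y z n]
  by (simp add: slash_closed slash_star star_slash star_pow_closed)

text \<open>The power sees \<open>y\<close> only through its right multiplication, a function
  restricted to \<open>Q\<close>, so agreement on \<open>Q\<close> suffices and no induction on
  \<open>n\<close> is needed.\<close>

lemma star_pow_cong_right:
  assumes "\<And>u. u \<in> Q \<Longrightarrow> u \<star> y = u \<star> z"
  shows "star_pow Q star n x y = star_pow Q star n x z"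
proof -
  have "right_mult Q star y = right_mult Q star z"
    unfolding right_mult_def by (rule restrict_ext) (rule assms)
  then show ?thesis
    by (simp only: star_pow_def)
qed

lemma star_pow_star_right:
  "\<lbrakk>y \<in> Q; z \<in> Q\<rbrakk> \<Longrightarrow> star_pow Q star n x (y \<star> z) = star_pow Q star n x y"
  by (rule star_pow_cong_right) (simp add: star_star_right)

lemma star_pow_slash_right:
  "\<lbrakk>y \<in> Q; z \<in> Q\<rbrakk> \<Longrightarrow> star_pow Q star n x (y \<oslash> z) = star_pow Q star n x y"
  by (rule star_pow_cong_right) (simp add: star_slash_right)

lemma star_pow_star_pow_right:
  "\<lbrakk>y \<in> Q; z \<in> Q\<rbrakk> \<Longrightarrow> star_pow Q star n x (star_pow Q star m y z) = star_pow Q star n x y"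
  by (rule star_pow_cong_right) (simp add: star_star_pow_right)

lemma oriented_bondle_star_pow:
  "oriented_bondle Q (star_pow Q star n) (star_pow Q star m) star slash"
proof (intro oriented_bondle.intro oriented_singquandle.intro
    oriented_singquandle_axioms.intro oriented_bondle_axioms.intro)
  show "quandle Q star slash"
    by unfold_locales
next
  fix x y z assume xyz: "x \<in> Q" "y \<in> Q" "z \<in> Q"
  \<comment> \<open>Both sides collapse to \<open>star_pow Q star n x y \<star> z\<close>.\<close>
  show "star_pow Q star n x (star_pow Q star n y x) \<star> z =
      star_pow Q star n (x \<star> z) (star_pow Q star n (y \<star> z) (x \<star> z))"
    using xyz by (simp add: star_closed star_pow_closed star_pow_star_pow_right star_pow_star_right
        star_pow_star_commute)
  \<comment> \<open>The right side collapses to \<open>(y \<star> z) \<star> x\<close>.\<close>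
  show "(y \<star> x) \<star> z = (y \<star> star_pow Q star n z x) \<star> star_pow Q star n (x \<star> z) z"
    using xyz star_commute[of y x z]
    by (simp add: star_closed star_star_pow_right star_star_right)
  show "(z \<oslash> star_pow Q star m y x) \<star> x = (z \<oslash> y) \<star> star_pow Q star m x y"
    using xyz by (simp add: slash_closed slash_star_pow_right star_star_pow_right)
next
  fix x y assume xy: "x \<in> Q" "y \<in> Q"
  \<comment> \<open>Both sides collapse to \<open>star_pow Q star n y x \<star> x\<close>.\<close>
  show "star_pow Q star n y x \<star> star_pow Q star n (x \<star> y) y =
      star_pow Q star n (y \<star> (x \<star> y)) (x \<star> y)"
    using xy by (simp add: star_closed star_pow_closed star_star_pow_right star_star_right
        star_pow_star_right star_pow_star_commute)
  \<comment> \<open>On the left the division moves inside the power, where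
    \<open>y \<oslash> y = y\<close>; both sides are \<open>star_pow Q star m y x\<close>.\<close>
  show "star_pow Q star m y x \<oslash> y = star_pow Q star m y (x \<oslash> star_pow Q star m x y)"
    using xy star_pow_slash_commute[of y x y m]
    by (simp add: slash_idem slash_star_pow_right star_pow_slash_right)
\<comment> \<open>What remains is closure together with OS1 and OB1, where \<open>z\<close> drops
  out of the right argument and commutes out of the left one.\<close>
qed (simp_all add: star_pow_closed star_pow_star_right star_pow_star_commute)

end

theorem lemma2p3:
  fixes Q :: "'a set" and star slash :: "'a \<Rightarrow> 'a \<Rightarrow> 'a"
  assumes "two_reductive_quandle Q star slash"
  shows "\<forall>n m :: int. oriented_bondle Q (star_pow Q star n) (star_pow Q star m) star slash"
  using two_reductive_quandle.oriented_bondle_star_pow[OF assms] by blast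

end
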